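(* For any integer $n\geq 1$, $$\Phi(D_n)=\left\lfloor\frac{n}{2}\right\rfloor \left\lceil\frac{n}{2}\right\rceil.$$
   Context: $D_n$ denotes the path graph (chain) on $n$ vertices $0,1,\dots,n-1$, with $a$ and $b$ adjacent iff $|a-b|=1$. For a connected graph $G$, a path system of $G$ is a set consisting of one chosen path in $G$ connecting $a$ and $b$ for each unordered pair $\{a,b\}$ of distinct vertices (for $D_n$ this path system is unique). A global packing of $(G,\mathcal{P})$ is a map $\omega:\mathcal{P}\to\{1,\dots,k\}$ such that $\omega(P)\neq\omega(P')$ whenever distinct paths $P,P'\in\mathcal{P}$ share at least one edge; $\Phi(G,\mathcal{P})$ is the minimum such $k$, and $\Phi(G)$ is the minimum of $\Phi(G,\mathcal{P})$ over all path systems of $G$. *)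

theory Defs
  imports Complex_Main
begin

record 'a ugraph =
  vertices :: "'a set"
  edges :: "'a set set"

definition path_graph :: "nat \<Rightarrow> nat ugraph" where
  "path_graph n = \<lparr>vertices = {0..<n},
     edges = {{a, b} | a b. a < n \<and> b < n \<and> \<bar>int a - int b\<bar> = 1}\<rparr>"

definition walk :: "'a ugraph \<Rightarrow> 'a list \<Rightarrow> bool" where
  "walk G xs \<longleftrightarrow> xs \<noteq> [] \<and> set xs \<subseteq> vertices G \<and>
     (\<forall>i. Suc i < length xs \<longrightarrow> {xs ! i, xs ! Suc i} \<in> edges G)"

definition trace :: "'a list \<Rightarrow> 'a ugraph" where
  "trace xs = \<lparr>vertices = set xs, edges = {{xs ! i, xs ! Suc i} | i. Suc i < length xs}\<rparr>"

text \<open>A path is the subgraph traced out by a walk without repeated vertices, so that a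
  path from a to b and its reversal are the same object.\<close>

definition connecting_path :: "'a ugraph \<Rightarrow> 'a \<Rightarrow> 'a \<Rightarrow> 'a ugraph \<Rightarrow> bool" where
  "connecting_path G a b P \<longleftrightarrow>
     (\<exists>xs. walk G xs \<and> distinct xs \<and> hd xs = a \<and> last xs = b \<and> P = trace xs)"

definition path_system :: "'a ugraph \<Rightarrow> 'a ugraph set \<Rightarrow> bool" where
  "path_system G \<P> \<longleftrightarrow>
     (\<forall>P\<in>\<P>. \<exists>a\<in>vertices G. \<exists>b\<in>vertices G. a \<noteq> b \<and> connecting_path G a b P) \<and>
     (\<forall>a\<in>vertices G. \<forall>b\<in>vertices G. a \<noteq> b \<longrightarrow> (\<exists>!P. P \<in> \<P> \<and> connecting_path G a b P))"

definition global_packing :: "'a ugraph set \<Rightarrow> nat \<Rightarrow> ('a ugraph \<Rightarrow> nat) \<Rightarrow> bool" where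
  "global_packing \<P> k \<omega> \<longleftrightarrow> \<omega> ` \<P> \<subseteq> {1..k} \<and>
     (\<forall>P\<in>\<P>. \<forall>P'\<in>\<P>. P \<noteq> P' \<and> edges P \<inter> edges P' \<noteq> {} \<longrightarrow> \<omega> P \<noteq> \<omega> P')"

text \<open>The graph enters the packing number of a pair (graph, path system) only through the
  path system. Both minima below are meant for finite connected graphs, where they are
  taken over nonempty sets.\<close>

definition Phi_system :: "'a ugraph set \<Rightarrow> nat" where
  "Phi_system \<P> = (LEAST k. \<exists>\<omega>. global_packing \<P> k \<omega>)"

definition Phi :: "'a ugraph \<Rightarrow> nat" where
  "Phi G = (LEAST k. \<exists>\<P>. path_system G \<P> \<and> k = Phi_system \<P>)"

end

theory Submission
  imports Defs
begin

text \<open>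
  The paths of the chain are its intervals. Put \<open>m = n div 2\<close>. The \<open>m * (n - m)\<close> intervals
  \<open>[a, b]\<close> with \<open>a < m \<le> b\<close> all contain the edge \<open>{m - 1, m}\<close>, which gives the lower bound.
  For the upper bound, let these crossing intervals be the colours. An interval \<open>[a, b]\<close>
  with \<open>b < m\<close> receives the crossing interval \<open>[b, m + a]\<close>, which only starts where \<open>[a, b]\<close>
  ends; an interval \<open>[a, b]\<close> with \<open>m \<le> a\<close> receives \<open>[b - m - 1, a]\<close>, which ends where
  \<open>[a, b]\<close> starts. On each half this assignment is injective, so no two intervals sharing
  an edge have the same colour.
\<close>

section \<open>Reversal of walks and traces\<close>

lemma walk_rev:
  assumes "walk G xs"
  shows "walk G (rev xs)"
  unfolding walk_def
proof (intro conjI allI impI)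
  show "rev xs \<noteq> []" "set (rev xs) \<subseteq> vertices G"
    using assms by (auto simp: walk_def)
next
  fix i assume i: "Suc i < length (rev xs)"
  \<comment> \<open>Step \<open>i\<close> of the reversed list is step \<open>j\<close> of
    \<open>xs\<close>, traversed backwards.\<close>
  define j where "j = length xs - Suc (Suc i)"
  have "{xs ! j, xs ! Suc j} \<in> edges G"
    using assms i by (auto simp: walk_def j_def)
  moreover have "rev xs ! i = xs ! Suc j" "rev xs ! Suc i = xs ! j"
    using i by (auto simp: rev_nth j_def Suc_diff_Suc)
  ultimately show "{rev xs ! i, rev xs ! Suc i} \<in> edges G"
    by (simp add: insert_commute)
qed

lemma edges_trace_rev_subset: "edges (trace (rev xs)) \<subseteq> edges (trace xs)"
proof
  fix e assume "e \<in> edges (trace (rev xs))"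
  then obtain i where e: "e = {rev xs ! i, rev xs ! Suc i}" and i: "Suc i < length xs"
    by (auto simp: trace_def)
  define j where "j = length xs - Suc (Suc i)"
  have "rev xs ! i = xs ! Suc j" "rev xs ! Suc i = xs ! j" "Suc j < length xs"
    using i by (auto simp: rev_nth j_def Suc_diff_Suc)
  then show "e \<in> edges (trace xs)"
    unfolding e by (auto simp: trace_def insert_commute intro!: exI[of _ j])
qed

lemma trace_rev: "trace (rev xs) = trace xs"
proof -
  have "edges (trace (rev xs)) = edges (trace xs)"
    using edges_trace_rev_subset[of xs] edges_trace_rev_subset[of "rev xs"] by auto
  then show ?thesis
    by (simp add: trace_def)
qed

text \<open>A trace forgets its direction, so the reversed walk yields the same subgraph. This
  reduces unordered pairs to the case \<open>a < b\<close>.\<close>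

lemma connecting_path_sym:
  assumes "connecting_path G a b P"
  shows "connecting_path G b a P"
proof -
  obtain xs where "walk G xs" "distinct xs" "hd xs = a" "last xs = b" "P = trace xs"
    using assms by (auto simp: connecting_path_def)
  then have "walk G (rev xs)" "distinct (rev xs)" "hd (rev xs) = b" "last (rev xs) = a"
    "P = trace (rev xs)"
    by (auto simp: walk_rev trace_rev hd_rev last_rev)
  then show ?thesis
    unfolding connecting_path_def by blast
qed

section \<open>Paths of the chain\<close>

lemma vertices_path_graph [simp]: "vertices (path_graph n) = {0..<n}"
  by (simp add: path_graph_def)

lemma edge_path_graph_iff:
  "{x, y} \<in> edges (path_graph n) \<longleftrightarrow> x < n \<and> y < n \<and> \<bar>int x - int y\<bar> = 1"
  by (auto simp: path_graph_def doubleton_eq_iff)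

text \<open>A walk with unit steps that never revisits a vertex cannot turn around.\<close>

lemma distinct_unit_steps_arithmetic:
  fixes xs :: "nat list"
  assumes dist: "distinct xs"
    and step: "\<And>i. Suc i < length xs \<Longrightarrow> \<bar>int (xs ! i) - int (xs ! Suc i)\<bar> = 1"
  shows "i < length xs \<Longrightarrow> int (xs ! i) = int (xs ! 0) + (int (xs ! 1) - int (xs ! 0)) * int i"
proof (induction i rule: less_induct)
  case (less i)
  \<comment> \<open>Two base cases, since a step is compared with the one before it. For
    \<open>i = 0\<close> the value \<open>xs ! 1\<close>, possibly out of range, is multiplied by
    0.\<close>
  consider "i = 0" | "i = 1" | j where "i = Suc (Suc j)"
    by (metis One_nat_def not0_implies_Suc)
  then show ?case
  proof cases
    case (3 j)
    define s where "s = int (xs ! 1) - int (xs ! 0)"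
    have s: "\<bar>s\<bar> = 1"
      using step[of 0] less.prems 3 by (simp add: s_def)
    have ih: "int (xs ! j) = int (xs ! 0) + s * int j"
      "int (xs ! Suc j) = int (xs ! 0) + s * int (Suc j)"
      using less.IH[of j] less.IH[of "Suc j"] less.prems 3 by (simp_all add: s_def)
    have "xs ! j \<noteq> xs ! i"
      using dist less.prems 3 by (simp add: nth_eq_iff_index_eq)
    moreover have "\<bar>int (xs ! Suc j) - int (xs ! i)\<bar> = 1"
      using step[of "Suc j"] less.prems 3 by simp
    ultimately have "int (xs ! i) = int (xs ! Suc j) + s"
      using ih s by (auto simp: algebra_simps abs_if split: if_splits)
    then show ?thesis
      using ih 3 by (simp add: s_def algebra_simps)
  qed simp_all
qed

lemma increasing_path_eq_upt:
  assumes w: "walk (path_graph n) xs" and dist: "distinct xs"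
    and lt: "hd xs < last xs"
  shows "xs = [hd xs..<Suc (last xs)]"
proof -
  have ne: "xs \<noteq> []"
    using w by (simp add: walk_def)
  have step: "\<bar>int (xs ! i) - int (xs ! Suc i)\<bar> = 1" if "Suc i < length xs" for i
    using w that by (simp add: walk_def edge_path_graph_iff)
  define s where "s = int (xs ! 1) - int (xs ! 0)"
  have ar: "int (xs ! i) = int (xs ! 0) + s * int i" if "i < length xs" for i
    using distinct_unit_steps_arithmetic[OF dist step that] by (simp add: s_def)
  have hd: "hd xs = xs ! 0" and last: "last xs = xs ! (length xs - 1)"
    using ne by (simp_all add: hd_conv_nth last_conv_nth)
  have len: "length xs \<ge> 2"
    using lt ne hd last by (cases xs; cases "tl xs") auto
  \<comment> \<open>The total displacement from \<open>hd xs\<close> to \<open>last xs\<close> is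
    positive, which rules out slope -1.\<close>
  have "s * int (length xs - 1) > 0"
    using ar[of "length xs - 1"] lt hd last ne by simp
  moreover have "s = 1 \<or> s = -1"
    using step[of 0] len by (auto simp: s_def)
  ultimately have "s = 1"
    by auto
  then have nth: "xs ! i = hd xs + i" if "i < length xs" for i
    using ar[OF that] hd by simp
  have "last xs = hd xs + (length xs - 1)"
    using nth[of "length xs - 1"] last ne by simp
  then show ?thesis
    using ne nth by (intro nth_equalityI) (auto simp del: upt_Suc)
qed

section \<open>Intervals and their common edges\<close>

definition interval_path :: "nat \<Rightarrow> nat \<Rightarrow> nat ugraph" where
  "interval_path a b = trace [a..<Suc b]"

lemma vertices_interval_path: "vertices (interval_path a b) = {a..b}"
  by (auto simp: interval_path_def trace_def)

lemma edges_interval_path: "edges (interval_path a b) = {{i, Suc i} | i. a \<le> i \<and> i < b}"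
proof -
  have "(\<exists>j. e = {[a..<Suc b] ! j, [a..<Suc b] ! Suc j} \<and> Suc j < Suc b - a) \<longleftrightarrow>
        (\<exists>i. e = {i, Suc i} \<and> a \<le> i \<and> i < b)" for e
  proof
    assume "\<exists>j. e = {[a..<Suc b] ! j, [a..<Suc b] ! Suc j} \<and> Suc j < Suc b - a"
    then obtain j where "e = {[a..<Suc b] ! j, [a..<Suc b] ! Suc j}" "Suc j < Suc b - a"
      by blast
    then show "\<exists>i. e = {i, Suc i} \<and> a \<le> i \<and> i < b"
      by (intro exI[of _ "a + j"]) (auto simp del: upt_Suc)
  next
    assume "\<exists>i. e = {i, Suc i} \<and> a \<le> i \<and> i < b"
    then obtain i where "e = {i, Suc i}" "a \<le> i" "i < b"
      by blast
    then show "\<exists>j. e = {[a..<Suc b] ! j, [a..<Suc b] ! Suc j} \<and> Suc j < Suc b - a"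
      by (intro exI[of _ "i - a"]) (auto simp del: upt_Suc)
  qed
  then show ?thesis
    by (auto simp: interval_path_def trace_def simp del: upt_Suc)
qed

text \<open>The endpoints can be read off from the vertex set \<open>{a..b}\<close>, which is
  nonempty because \<open>a \<le> b\<close>.\<close>

lemma interval_path_eq_iff:
  assumes "a \<le> b"
  shows "interval_path a b = interval_path c d \<longleftrightarrow> a = c \<and> b = d"
  using assms by (metis Icc_eq_Icc vertices_interval_path)

lemma interval_paths_share_edge_iff:
  "edges (interval_path a b) \<inter> edges (interval_path c d) \<noteq> {} \<longleftrightarrow> max a c < min b d"
proof
  assume "edges (interval_path a b) \<inter> edges (interval_path c d) \<noteq> {}"
  then show "max a c < min b d"
    by (auto simp: edges_interval_path doubleton_eq_iff)
next
  assume "max a c < min b d"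
  \<comment> \<open>The intersection of the two intervals starts at \<open>max a c\<close>; its
    first edge lies in both.\<close>
  then have "{max a c, Suc (max a c)} \<in> edges (interval_path a b) \<inter> edges (interval_path c d)"
    unfolding edges_interval_path by (auto simp del: max_Suc_Suc)
  then show "edges (interval_path a b) \<inter> edges (interval_path c d) \<noteq> {}"
    by blast
qed

lemma connecting_path_path_graph_iff:
  assumes "a < b" "b < n"
  shows "connecting_path (path_graph n) a b P \<longleftrightarrow> P = interval_path a b"
proof
  assume "connecting_path (path_graph n) a b P"
  then obtain xs where "walk (path_graph n) xs" "distinct xs" "hd xs = a" "last xs = b"
    "P = trace xs"
    by (auto simp: connecting_path_def)
  then show "P = interval_path a b"
    using increasing_path_eq_upt[of n xs] assms by (simp add: interval_path_def del: upt_Suc)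
next
  assume "P = interval_path a b"
  moreover have "walk (path_graph n) [a..<Suc b]"
    using assms by (auto simp: walk_def edge_path_graph_iff simp del: upt_Suc)
  moreover have "hd [a..<Suc b] = a" "last [a..<Suc b] = b"
    using assms by (simp_all add: hd_upt del: upt_Suc)
  ultimately show "connecting_path (path_graph n) a b P"
    unfolding connecting_path_def interval_path_def
    by (intro exI[of _ "[a..<Suc b]"]) (simp del: upt_Suc)
qed

section \<open>The unique path system of the chain\<close>

definition interval_system :: "nat \<Rightarrow> nat ugraph set" where
  "interval_system n = {interval_path a b | a b. a < b \<and> b < n}"

lemma connecting_path_min_max:
  assumes "a \<noteq> b" "a < n" "b < n"
  shows "connecting_path (path_graph n) a b P \<longleftrightarrow> P = interval_path (min a b) (max a b)"
proof (cases "a < b")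
  case True
  then show ?thesis
    using assms connecting_path_path_graph_iff[of a b n P] by (simp add: min_def max_def)
next
  case False
  then have "connecting_path (path_graph n) b a P \<longleftrightarrow> P = interval_path b a"
    using assms by (intro connecting_path_path_graph_iff) auto
  then show ?thesis
    using False by (auto simp: min_def max_def dest: connecting_path_sym)
qed

text \<open>Each pair of distinct vertices is joined by exactly one path, so no choice remains and
  the outer minimum in \<open>Phi\<close> ranges over a single system.\<close>

lemma path_system_path_graph_iff:
  "path_system (path_graph n) \<P> \<longleftrightarrow> \<P> = interval_system n"
proof
  assume sys: "path_system (path_graph n) \<P>"
  show "\<P> = interval_system n"
  proof (intro equalityI subsetI)
    fix P assume "P \<in> \<P>"
    then obtain a b where ab: "a < n" "b < n" "a \<noteq> b" "connecting_path (path_graph n) a b P"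
      using sys by (auto simp: path_system_def)
    then have "P = interval_path (min a b) (max a b)"
      by (simp add: connecting_path_min_max)
    moreover have "min a b < max a b" "max a b < n"
      using ab by auto
    ultimately show "P \<in> interval_system n"
      unfolding interval_system_def by blast
  next
    fix P assume "P \<in> interval_system n"
    then obtain a b where ab: "a < b" "b < n" "P = interval_path a b"
      by (auto simp: interval_system_def)
    then have "a \<in> vertices (path_graph n)" "b \<in> vertices (path_graph n)" "a \<noteq> b"
      by auto
    then obtain Q where "Q \<in> \<P>" "connecting_path (path_graph n) a b Q"
      using sys unfolding path_system_def by blast
    then show "P \<in> \<P>"
      using ab connecting_path_path_graph_iff by simp
  qed
next
  assume eq: "\<P> = interval_system n"
  show "path_system (path_graph n) \<P>"
    unfolding path_system_def
  proof (intro conjI ballI impI)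
    fix P assume "P \<in> \<P>"
    then obtain a b where "a < b" "b < n" "P = interval_path a b"
      by (auto simp: eq interval_system_def)
    then show "\<exists>a\<in>vertices (path_graph n). \<exists>b\<in>vertices (path_graph n).
        a \<noteq> b \<and> connecting_path (path_graph n) a b P"
      by (intro bexI[of _ a] bexI[of _ b]) (auto simp: connecting_path_path_graph_iff)
  next
    fix a b assume ab: "a \<in> vertices (path_graph n)" "b \<in> vertices (path_graph n)" "a \<noteq> b"
    then have "min a b < max a b" "max a b < n"
      by auto
    then have "interval_path (min a b) (max a b) \<in> \<P>"
      unfolding eq interval_system_def by blast
    then show "\<exists>!P. P \<in> \<P> \<and> connecting_path (path_graph n) a b P"
      using ab by (auto simp: connecting_path_min_max)
  qed
qed

lemma Phi_path_graph: "Phi (path_graph n) = Phi_system (interval_system n)"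
  unfolding Phi_def path_system_path_graph_iff by (simp add: Least_equality)

section \<open>Lower bound, for an arbitrary cut position\<close>

lemma global_packing_lower_bound:
  assumes pack: "global_packing (interval_system n) k \<omega>"
  shows "m * (n - m) \<le> k"
proof -
  let ?A = "{..<m} \<times> {m..<n}" and ?f = "\<lambda>(a, b). \<omega> (interval_path a b)"
  have mem: "interval_path a b \<in> interval_system n" if "(a, b) \<in> ?A" for a b
  proof -
    have "a < b" "b < n"
      using that by auto
    then show ?thesis
      unfolding interval_system_def by blast
  qed
  have "inj_on ?f ?A"
  proof (rule inj_onI)
    fix x y assume xy: "x \<in> ?A" "y \<in> ?A" "?f x = ?f y"
    obtain a b c d where x: "x = (a, b)" and y: "y = (c, d)"
      by (metis surj_pair)
    have ab: "a \<in> {..<m}" "b \<in> {m..<n}" and cd: "c \<in> {..<m}" "d \<in> {m..<n}"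
      and same: "\<omega> (interval_path a b) = \<omega> (interval_path c d)"
      using xy x y by auto
    \<comment> \<open>Both left ends lie below \<open>m\<close> and both right ends are at least
      \<open>m\<close>, so \<open>max a c < min b d\<close>.\<close>
    have "edges (interval_path a b) \<inter> edges (interval_path c d) \<noteq> {}"
      using ab cd by (simp add: interval_paths_share_edge_iff)
    moreover have "interval_path a b \<in> interval_system n" "interval_path c d \<in> interval_system n"
      using mem ab cd by blast+
    ultimately have "interval_path a b = interval_path c d"
      using pack same unfolding global_packing_def by blast
    then show "x = y"
      using ab x y by (simp add: interval_path_eq_iff)
  qed
  moreover have "?f ` ?A \<subseteq> {1..k}"
    using pack mem by (force simp: global_packing_def)
  ultimately have "card ?A \<le> card {1..k}"
    by (intro card_inj_on_le[of ?f]) auto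
  then show ?thesis
    by (simp add: card_cartesian_product)
qed

section \<open>Upper bound by an explicit colouring\<close>

definition crossing_colour :: "nat \<Rightarrow> nat \<Rightarrow> nat \<Rightarrow> nat \<times> nat" where
  "crossing_colour m a b =
     (if b < m then (b, m + a) else if m \<le> a then (b - m - 1, a) else (a, b))"

text \<open>If \<open>b < m\<close>, then \<open>m + a < 2 * m \<le> n\<close>. If
  \<open>m \<le> a\<close>, then \<open>b \<ge> m + 1\<close>, so the subtraction does not truncate,
  and \<open>b < n \<le> 2 * m + 1\<close> gives \<open>b - m - 1 < m\<close>.\<close>

lemma crossing_colour_mem:
  assumes "a < b" "b < n" "m = n div 2"
  shows "crossing_colour m a b \<in> {..<m} \<times> {m..<n}"
  using assms by (auto simp: crossing_colour_def)

text \<open>Within one of the three cases the colour determines both ends; the overlap forces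
  \<open>a < b\<close> and \<open>c < d\<close>, so \<open>b - m - 1\<close> is exact. Intervals in
  opposite halves do not overlap. If just one interval is crossing, equal colours make it start
  where the other ends or end where the other starts, leaving no common edge.\<close>

lemma crossing_colour_inj:
  assumes "crossing_colour m a b = crossing_colour m c d" "max a c < min b d"
  shows "a = c \<and> b = d"
  using assms by (auto simp: crossing_colour_def split: if_splits)

lemma global_packing_interval_system:
  assumes m: "m = n div 2"
  shows "\<exists>\<omega>. global_packing (interval_system n) (m * (n - m)) \<omega>"
proof -
  \<comment> \<open>The bijection \<open>h\<close> numbers the crossing pairs, turning them into
    colours from 1 to \<open>m * (n - m)\<close>.\<close>
  have "card ({..<m} \<times> {m..<n}) = card {1..m * (n - m)}"
    by (simp add: card_cartesian_product)
  then obtain h where h: "bij_betw h ({..<m} \<times> {m..<n}) {1..m * (n - m)}"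
    using finite_same_card_bij[of "{..<m} \<times> {m..<n}" "{1..m * (n - m)}"] by auto
  \<comment> \<open>A packing is a function of subgraphs, so the ends of the interval are recovered
    as the extreme vertices.\<close>
  define \<omega> where "\<omega> P = h (crossing_colour m (Min (vertices P)) (Max (vertices P)))"
    for P :: "nat ugraph"
  have \<omega>: "\<omega> (interval_path a b) = h (crossing_colour m a b)" if "a < b" for a b
  proof -
    have "Min {a..b} = a" "Max {a..b} = b"
      using that by (auto intro: Min_eqI Max_eqI)
    then show ?thesis
      by (simp add: \<omega>_def vertices_interval_path)
  qed
  have "\<omega> ` interval_system n \<subseteq> {1..m * (n - m)}"
    using bij_betw_apply[OF h] crossing_colour_mem[OF _ _ m]
    by (force simp: interval_system_def \<omega>)
  moreover have "\<omega> P \<noteq> \<omega> Q"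
    if PQ: "P \<in> interval_system n" "Q \<in> interval_system n" "P \<noteq> Q"
      "edges P \<inter> edges Q \<noteq> {}" for P Q
  proof
    assume same: "\<omega> P = \<omega> Q"
    obtain a b c d where ab: "a < b" "b < n" "P = interval_path a b"
      and cd: "c < d" "d < n" "Q = interval_path c d"
      using PQ by (auto simp: interval_system_def)
    \<comment> \<open>Both pairs lie in the domain of \<open>h\<close>, where it can be
      cancelled.\<close>
    have "crossing_colour m a b = crossing_colour m c d"
      using same ab cd crossing_colour_mem[OF _ _ m] bij_betw_imp_inj_on[OF h]
      by (simp add: \<omega> inj_on_eq_iff)
    moreover have "max a c < min b d"
      using PQ(4) ab cd interval_paths_share_edge_iff by blast
    ultimately show False
      using crossing_colour_inj PQ(3) ab cd by blast
  qed
  ultimately show ?thesis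
    unfolding global_packing_def by blast
qed

section \<open>The value of the packing number\<close>

lemma Phi_system_interval_system:
  "Phi_system (interval_system n) = n div 2 * (n - n div 2)"
  unfolding Phi_system_def
  using global_packing_interval_system[OF refl] global_packing_lower_bound[of n _ _ "n div 2"]
  by (intro Least_equality) auto

theorem theorem3:
  fixes n :: nat
  assumes "n \<ge> 1"
  shows "int (Phi (path_graph n)) = \<lfloor>real n / 2\<rfloor> * \<lceil>real n / 2\<rceil>"
proof -
  \<comment> \<open>The two halves add up to \<open>n\<close>, so the ceiling is
    \<open>n - n div 2\<close>.\<close>
  have "\<lfloor>real n / 2\<rfloor> = int (n div 2)" "\<lceil>real n / 2\<rceil> = int (n - n div 2)"
    by linarith+
  then show ?thesis
    by (simp add: Phi_path_graph Phi_system_interval_system)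
qed

end
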